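(* Let $m,n,k_1,\ldots,k_m,l_1,\ldots,l_n$ be positive integers. Then for any integer $j$ with $1\leqslant j\leqslant m$, the following identities hold in $\mathfrak{h}^1$: $$z_{k_1}z_{k_2}\cdots z_{k_m} \ast z_{l_1}z_{l_2}\cdots z_{l_n}=\sum_{i=0}^n\Big[(z_{k_1}\cdots z_{k_{j-1}}\ast z_{l_1}\cdots z_{l_i})z_{k_j}+(z_{k_1}\cdots z_{k_{j-1}}\ast z_{l_1}\cdots z_{l_{i-1}})z_{k_j+l_i}\Big](z_{k_{j+1}}\cdots z_{k_{m}}\ast z_{l_{i+1}}\cdots z_{l_{n}})$$ and $$z_{k_1}z_{k_2}\cdots z_{k_m} \,\bar{\ast}\, z_{l_1}z_{l_2}\cdots z_{l_n}=\sum_{i=0}^n\Big[(z_{k_1}\cdots z_{k_{j-1}}\,\bar{\ast}\, z_{l_1}\cdots z_{l_i})z_{k_j}-(z_{k_1}\cdots z_{k_{j-1}}\,\bar{\ast}\, z_{l_1}\cdots z_{l_{i-1}})z_{k_j+l_i}\Big](z_{k_{j+1}}\cdots z_{k_{m}}\,\bar{\ast}\, z_{l_{i+1}}\cdots z_{l_{n}}).$$ Here, by convention, $z_{k_i}\cdots z_{k_{i-1}}=1$ and $z_{k_i}\cdots z_{k_{i-2}}=0$ for any integer $i$, and likewise for products of the letters $z_{l_i}$.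
   Context: Let $Y=\{z_k\mid k=1,2,\ldots\}$ be an alphabet of noncommuting letters, $Y^{\ast}$ the set of all words in the letters of $Y$ (including the empty word $1$), and $\mathfrak{h}^1=\mathbb{Q}\langle Y\rangle$ the noncommutative polynomial algebra over $\mathbb{Q}$ generated by $Y$; it has $Y^{\ast}$ as a $\mathbb{Q}$-basis, and juxtaposition denotes the concatenation product. The two stuffle products $\ast$ and $\bar{\ast}$ are the $\mathbb{Q}$-bilinear products on $\mathfrak{h}^1$ defined recursively by $$1\ast w=w\ast 1=w,\qquad z_kw_1\ast z_lw_2=z_k(w_1\ast z_lw_2)+z_l(z_kw_1\ast w_2)+z_{k+l}(w_1\ast w_2),$$ $$1\,\bar{\ast}\, w=w\,\bar{\ast}\, 1=w,\qquad z_kw_1\,\bar{\ast}\, z_lw_2=z_k(w_1\,\bar{\ast}\, z_lw_2)+z_l(z_kw_1\,\bar{\ast}\, w_2)-z_{k+l}(w_1\,\bar{\ast}\, w_2),$$ for all words $w,w_1,w_2\in Y^{\ast}$ and positive integers $k,l$. Both products are commutative and associative. By the stated convention, for $i=0$ one has $z_{l_1}\cdots z_{l_0}=1$ and $z_{l_1}\cdots z_{l_{-1}}=0$, so the second term in the bracket (the one involving $z_{k_j+l_i}$) vanishes for $i=0$. *)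

theory Defs
  imports Complex_Main "HOL-Library.Poly_Mapping"
begin

text \<open>The value \<open>z 0\<close> is an unspecified letter; only \<open>z k\<close> with \<open>0 < k\<close> is meaningful.\<close>

typedef letter = "{k::nat. 0 < k}"
  morphisms index z
  by auto

lemma index_z [simp]: "0 < k \<Longrightarrow> index (z k) = k"
  by (simp add: z_inverse)

lemma index_pos [simp]: "0 < index a"
  using index by auto

lemma z_index [simp]: "z (index a) = a"
  by (rule index_inverse)

text \<open>
  The words form a free monoid, written additively because the convolution product on
  \<^type>\<open>poly_mapping\<close> is formed with respect to an additive (not necessarily commutative) monoid.
\<close>

datatype word = Word (letters: "letter list")

instantiation word :: monoid_add
begin

definition zero_word :: word
  where "0 = Word []"

definition plus_word :: "word \<Rightarrow> word \<Rightarrow> word"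
  where "u + v = Word (letters u @ letters v)"

instance
  by standard (simp_all add: zero_word_def plus_word_def)

end

text \<open>
  Thus \<open>*\<close> and \<open>1\<close> on the following type are the concatenation product and the empty word.
\<close>

type_synonym h1 = "word \<Rightarrow>\<^sub>0 rat"

definition of_word :: "letter list \<Rightarrow> h1"
  where "of_word w = Poly_Mapping.single (Word w) 1"

definition zgen :: "nat \<Rightarrow> h1"
  where "zgen k = of_word [z k]"

lemma of_word_Nil [simp]: "of_word [] = 1"
  by (simp add: of_word_def flip: zero_word_def)

lemma of_word_append: "of_word (u @ v) = of_word u * of_word v"
  by (simp add: of_word_def mult_single plus_word_def)

lemma of_word_Cons: "of_word (a # w) = zgen (index a) * of_word w"
  using of_word_append[of "[a]" w] by (simp add: zgen_def)

fun stuffle_words :: "letter list \<Rightarrow> letter list \<Rightarrow> h1"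
  where
    "stuffle_words [] w = of_word w"
  | "stuffle_words w [] = of_word w"
  | "stuffle_words (a # u) (b # v) =
       zgen (index a) * stuffle_words u (b # v)
     + zgen (index b) * stuffle_words (a # u) v
     + zgen (index a + index b) * stuffle_words u v"

fun bar_stuffle_words :: "letter list \<Rightarrow> letter list \<Rightarrow> h1"
  where
    "bar_stuffle_words [] w = of_word w"
  | "bar_stuffle_words w [] = of_word w"
  | "bar_stuffle_words (a # u) (b # v) =
       zgen (index a) * bar_stuffle_words u (b # v)
     + zgen (index b) * bar_stuffle_words (a # u) v
     - zgen (index a + index b) * bar_stuffle_words u v"

text \<open>
  Left multiplication by \<open>Poly_Mapping.single 0 c\<close> is multiplication by the scalar \<open>c\<close>.
\<close>

definition bilinear_ext :: "(letter list \<Rightarrow> letter list \<Rightarrow> h1) \<Rightarrow> h1 \<Rightarrow> h1 \<Rightarrow> h1"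
  where "bilinear_ext f p q =
    (\<Sum>u\<in>Poly_Mapping.keys p. \<Sum>v\<in>Poly_Mapping.keys q.
       Poly_Mapping.single 0 (Poly_Mapping.lookup p u * Poly_Mapping.lookup q v)
         * f (letters u) (letters v))"

definition stuffle :: "h1 \<Rightarrow> h1 \<Rightarrow> h1"  (infixl "\<star>" 70)
  where "p \<star> q = bilinear_ext stuffle_words p q"

definition bar_stuffle :: "h1 \<Rightarrow> h1 \<Rightarrow> h1"  (infixl "\<star>\<^sup>-" 70)
  where "p \<star>\<^sup>- q = bilinear_ext bar_stuffle_words p q"

lemma bilinear_ext_of_word [simp]: "bilinear_ext f (of_word u) (of_word v) = f u v"
  by (simp add: bilinear_ext_def of_word_def)

lemma bilinear_ext_superset:
  assumes "finite A" "Poly_Mapping.keys p \<subseteq> A" "finite B" "Poly_Mapping.keys q \<subseteq> B"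
  shows "bilinear_ext f p q =
    (\<Sum>u\<in>A. \<Sum>v\<in>B. Poly_Mapping.single 0 (Poly_Mapping.lookup p u * Poly_Mapping.lookup q v)
         * f (letters u) (letters v))"
proof -
  have "bilinear_ext f p q = (\<Sum>u\<in>Poly_Mapping.keys p. \<Sum>v\<in>B.
      Poly_Mapping.single 0 (Poly_Mapping.lookup p u * Poly_Mapping.lookup q v)
         * f (letters u) (letters v))"
    unfolding bilinear_ext_def using assms
    by (intro sum.cong refl sum.mono_neutral_left) (auto simp: in_keys_iff)
  also have "\<dots> = (\<Sum>u\<in>A. \<Sum>v\<in>B.
      Poly_Mapping.single 0 (Poly_Mapping.lookup p u * Poly_Mapping.lookup q v)
         * f (letters u) (letters v))"
    using assms by (intro sum.mono_neutral_left) (auto simp: in_keys_iff)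
  finally show ?thesis .
qed

lemma bilinear_ext_add_left:
  "bilinear_ext f (p + p') q = bilinear_ext f p q + bilinear_ext f p' q"
proof -
  let ?A = "Poly_Mapping.keys p \<union> Poly_Mapping.keys p'" and ?B = "Poly_Mapping.keys q"
  have "Poly_Mapping.keys (p + p') \<subseteq> ?A" by (rule keys_add)
  then show ?thesis
    by (simp add: bilinear_ext_superset[of ?A _ ?B] lookup_add single_add algebra_simps
        flip: sum.distrib)
qed

lemma bilinear_ext_add_right:
  "bilinear_ext f p (q + q') = bilinear_ext f p q + bilinear_ext f p q'"
proof -
  let ?A = "Poly_Mapping.keys p" and ?B = "Poly_Mapping.keys q \<union> Poly_Mapping.keys q'"
  have "Poly_Mapping.keys (q + q') \<subseteq> ?B" by (rule keys_add)
  then show ?thesis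
    by (simp add: bilinear_ext_superset[of ?A _ ?B] lookup_add single_add algebra_simps
        flip: sum.distrib)
qed

text \<open>
  The product \<open>z\<^bsub>k a\<^esub> \<dots> z\<^bsub>k b\<^esub>\<close>, which is \<open>1\<close> for \<open>b = a - 1\<close> and \<open>0\<close> for \<open>b = a - 2\<close>. The
  indices are integers because \<open>b = - 1\<close> occurs with \<open>a = 1\<close>.
\<close>

definition zprod :: "(int \<Rightarrow> nat) \<Rightarrow> int \<Rightarrow> int \<Rightarrow> h1"
  where "zprod k a b = (if b < a - 1 then 0 else prod_list (map (\<lambda>i. zgen (k i)) [a..b]))"

end

theory Submission
  imports Defs
begin

text \<open>
  A term of \<open>z\<^bsub>k 1\<^esub> \<dots> z\<^bsub>k m\<^esub> \<star> z\<^bsub>l 1\<^esub> \<dots> z\<^bsub>l n\<^esub>\<close> is a way of interleaving the two words in which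
  some letters of the first are merged with letters of the second. The chosen letter \<open>z\<^bsub>k j\<^esub>\<close>
  gives rise to exactly one letter of the term, and the term is cut just behind that letter. If
  \<open>i\<close> letters of the second word have been used up to the cut, then what follows is an arbitrary
  term of \<open>z\<^bsub>k (j+1)\<^esub> \<dots> z\<^bsub>k m\<^esub> \<star> z\<^bsub>l (i+1)\<^esub> \<dots> z\<^bsub>l n\<^esub>\<close>, while the part before the cut is either a term of
  \<open>z\<^bsub>k 1\<^esub> \<dots> z\<^bsub>k (j-1)\<^esub> \<star> z\<^bsub>l 1\<^esub> \<dots> z\<^bsub>l i\<^esub>\<close> followed by \<open>z\<^bsub>k j\<^esub>\<close> on its own, or a term of
  \<open>z\<^bsub>k 1\<^esub> \<dots> z\<^bsub>k (j-1)\<^esub> \<star> z\<^bsub>l 1\<^esub> \<dots> z\<^bsub>l (i-1)\<^esub>\<close> followed by the merged letter \<open>z\<^bsub>k j + l i\<^esub>\<close>. For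
  the barred product every merging costs a sign, and the same decomposition applies.

  The two products are the cases \<open>c = 1\<close> and \<open>c = - 1\<close> of a stuffle product in which every
  merging is weighted by an integer \<open>c\<close>. For this product the possible first parts, summed up in
  \<open>cut_head\<close>, satisfy the same recursion as the product itself (lemma \<open>cut_head_Cons_Cons\<close>), so
  the decomposition (lemma \<open>weighted_stuffle_cut\<close>) follows by induction on the two words.
\<close>

section \<open>Stuffle products with weighted merging\<close>

fun weighted_stuffle :: "int \<Rightarrow> letter list \<Rightarrow> letter list \<Rightarrow> h1"
  where
    "weighted_stuffle c [] w = of_word w"
  | "weighted_stuffle c w [] = of_word w"
  | "weighted_stuffle c (a # u) (b # v) =
       zgen (index a) * weighted_stuffle c u (b # v)
     + zgen (index b) * weighted_stuffle c (a # u) v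
     + of_int c * (zgen (index a + index b) * weighted_stuffle c u v)"

lemma weighted_stuffle_Nil_right [simp]: "weighted_stuffle c w [] = of_word w"
  by (cases w) simp_all

lemma stuffle_words_eq_weighted: "stuffle_words u v = weighted_stuffle 1 u v"
  by (induction u v rule: stuffle_words.induct) simp_all

lemma bar_stuffle_words_eq_weighted: "bar_stuffle_words u v = weighted_stuffle (- 1) u v"
  by (induction u v rule: bar_stuffle_words.induct) simp_all

lemma zgen_mult_of_int_left_commute: "zgen p * (of_int c * w) = of_int c * (zgen p * w)"
  by (metis mult.assoc mult_of_int_commute)

section \<open>Cutting behind a letter\<close>

text \<open>
  The sum of those terms of the product of \<open>u @ [a]\<close> and \<open>w\<close> whose last letter comes from \<open>a\<close>,
  alone or merged.
\<close>

definition cut_head :: "int \<Rightarrow> letter list \<Rightarrow> letter \<Rightarrow> letter list \<Rightarrow> h1"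
  where "cut_head c u a w = weighted_stuffle c u w * zgen (index a)
    + (if w = [] then 0
       else of_int c * (weighted_stuffle c u (butlast w) * zgen (index a + index (last w))))"

lemma cut_head_Cons_Nil: "cut_head c (x # u) a [] = zgen (index x) * cut_head c u a []"
  by (simp add: cut_head_def of_word_Cons mult.assoc)

text \<open>
  With nothing left in front of \<open>a\<close>, the first letter is \<open>b\<close> or \<open>a\<close> merged with \<open>b\<close>; in the second
  case the cut comes immediately, so \<open>b\<close> must be the last letter of the head.
\<close>

lemma cut_head_Nil_Cons:
  "cut_head c [] a (b # w) = zgen (index b) * cut_head c [] a w
     + (if w = [] then of_int c * zgen (index a + index b) else 0)"
  by (simp add: cut_head_def of_word_Cons algebra_simps zgen_mult_of_int_left_commute)

text \<open>
  As \<open>x\<close> stands in front of \<open>a\<close>, reading the first letter of a term never consumes \<open>a\<close>, so the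
  recursion of the product carries over. In particular, a term in which \<open>a\<close> is merged with \<open>b\<close>
  (possible for \<open>w = []\<close> only) begins with \<open>x\<close> and belongs to the first summand.
\<close>

lemma cut_head_Cons_Cons:
  "cut_head c (x # u) a (b # w) =
     zgen (index x) * cut_head c u a (b # w)
   + zgen (index b) * cut_head c (x # u) a w
   + of_int c * (zgen (index x + index b) * cut_head c u a w)"
  by (simp add: cut_head_def of_word_Cons algebra_simps zgen_mult_of_int_left_commute)

theorem weighted_stuffle_cut:
  "weighted_stuffle c (u @ a # u') v =
     (\<Sum>i\<le>length v. cut_head c u a (take i v) * weighted_stuffle c u' (drop i v))"
proof (induction u arbitrary: v)
  case Nil
  show ?case
  proof (induction v)
    case Nil
    show ?case by (simp add: cut_head_def of_word_Cons)
  next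
    case (Cons b v)
    \<comment> \<open>The merging of \<open>a\<close> with \<open>b\<close> contributes to the cut directly behind \<open>b\<close> only.\<close>
    have merged: "(\<Sum>i\<le>length v. (if take i v = [] then of_int c * zgen (index a + index b) else 0)
          * weighted_stuffle c u' (drop i v))
        = of_int c * zgen (index a + index b) * weighted_stuffle c u' v"
    proof -
      have "(\<Sum>i\<le>length v. (if take i v = [] then of_int c * zgen (index a + index b) else 0)
          * weighted_stuffle c u' (drop i v))
        = (\<Sum>i\<le>length v. if i = 0 then of_int c * zgen (index a + index b)
          * weighted_stuffle c u' (drop i v) else 0)"
        by (intro sum.cong) auto
      then show ?thesis by simp
    qed
    have "(\<Sum>i\<le>length (b # v). cut_head c [] a (take i (b # v))
          * weighted_stuffle c u' (drop i (b # v)))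
        = zgen (index a) * weighted_stuffle c u' (b # v)
        + (\<Sum>i\<le>length v. cut_head c [] a (b # take i v) * weighted_stuffle c u' (drop i v))"
      by (simp add: sum.atMost_Suc_shift cut_head_def del: sum.atMost_Suc)
    also have "(\<Sum>i\<le>length v. cut_head c [] a (b # take i v) * weighted_stuffle c u' (drop i v))
        = zgen (index b) * weighted_stuffle c (a # u') v
        + of_int c * zgen (index a + index b) * weighted_stuffle c u' v"
      using Cons merged
      by (simp only: cut_head_Nil_Cons distrib_right sum.distrib mult.assoc sum_distrib_left
          append_Nil)
    finally show ?case by (simp add: mult.assoc add.assoc)
  qed
next
  case outer: (Cons x u)
  show ?case
  proof (induction v)
    case Nil
    show ?case using outer[of "[]"] by (simp add: cut_head_Cons_Nil of_word_Cons mult.assoc)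
  next
    case inner: (Cons b v)
    define T where "T w i = weighted_stuffle c u' (drop i w)" for w i
    have shift: "(\<Sum>i\<le>length (b # v). cut_head c y a (take i (b # v)) * T (b # v) i)
        = cut_head c y a [] * T (b # v) 0
        + (\<Sum>i\<le>length v. cut_head c y a (b # take i v) * T v i)" for y
      by (simp add: sum.atMost_Suc_shift T_def del: sum.atMost_Suc)
    have "(\<Sum>i\<le>length (b # v). cut_head c (x # u) a (take i (b # v)) * T (b # v) i)
        = zgen (index x) * (\<Sum>i\<le>length (b # v). cut_head c u a (take i (b # v)) * T (b # v) i)
        + zgen (index b) * (\<Sum>i\<le>length v. cut_head c (x # u) a (take i v) * T v i)
        + of_int c * (zgen (index x + index b)
            * (\<Sum>i\<le>length v. cut_head c u a (take i v) * T v i))"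
      unfolding shift
      by (simp add: cut_head_Cons_Nil cut_head_Cons_Cons distrib_right distrib_left sum.distrib
          mult.assoc sum_distrib_left add.assoc)
    also have "\<dots> = weighted_stuffle c ((x # u) @ a # u') (b # v)"
      using inner by (simp only: T_def outer append_Cons weighted_stuffle.simps)
    finally show ?case by (simp only: T_def)
  qed
qed

section \<open>Products of consecutive generators\<close>

lemma zprod_eq_of_word:
  assumes "a - 1 \<le> b" "\<And>i. a \<le> i \<Longrightarrow> i \<le> b \<Longrightarrow> 0 < k i"
  shows "zprod k a b = of_word (map (\<lambda>i. z (k i)) [a..b])"
proof -
  have "prod_list (map (\<lambda>i. zgen (k i)) xs) = of_word (map (\<lambda>i. z (k i)) xs)"
    if "\<forall>i\<in>set xs. 0 < k i" for xs
    using that by (induction xs) (simp_all add: of_word_Cons)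
  with assms show ?thesis by (simp add: zprod_def)
qed

lemma bilinear_ext_zero_right [simp]: "bilinear_ext f p 0 = 0"
  by (simp add: bilinear_ext_def)

lemma upto_append:
  fixes i n :: int
  assumes "0 \<le> i" "i \<le> n"
  shows "[1..n] = [1..i] @ [i + 1..n]"
proof (cases "i = 0")
  case False
  with assms show ?thesis by (intro upto_split2) simp_all
qed simp

lemma take_upto: "i \<le> nat n \<Longrightarrow> take i [1..n] = [1..int i]"
  and drop_upto: "i \<le> nat n \<Longrightarrow> drop i [1..n] = [int i + 1..n]"
  using upto_append[of "int i" n] by (cases "0 \<le> n"; simp add: nat_le_iff)+

lemma bilinear_ext_zprod_cut:
  fixes m n j :: int
  assumes f: "\<And>u v. f u v = weighted_stuffle c u v"
    and k: "\<And>i. 1 \<le> i \<Longrightarrow> i \<le> m \<Longrightarrow> 0 < k i"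
    and l: "\<And>i. 1 \<le> i \<Longrightarrow> i \<le> n \<Longrightarrow> 0 < l i"
    and n: "0 \<le> n" and j: "1 \<le> j" "j \<le> m"
  shows "bilinear_ext f (zprod k 1 m) (zprod l 1 n) =
    (\<Sum>i\<in>{0..n}. (bilinear_ext f (zprod k 1 (j - 1)) (zprod l 1 i) * zgen (k j)
        + of_int c * (bilinear_ext f (zprod k 1 (j - 1)) (zprod l 1 (i - 1)) * zgen (k j + l i)))
      * bilinear_ext f (zprod k (j + 1) m) (zprod l (i + 1) n))"
proof -
  define K L where "K = map (\<lambda>i. z (k i))" and "L = map (\<lambda>i. z (l i))"
  have zK: "zprod k p q = of_word (K [p..q])" if "1 \<le> p" "p - 1 \<le> q" "q \<le> m" for p q
    using that k by (simp add: zprod_eq_of_word K_def)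
  have zL: "zprod l p q = of_word (L [p..q])" if "1 \<le> p" "p - 1 \<le> q" "q \<le> n" for p q
    using that l by (simp add: zprod_eq_of_word L_def)
  have head: "cut_head c (K [1..j - 1]) (z (k j)) (L [1..i])
      = bilinear_ext f (zprod k 1 (j - 1)) (zprod l 1 i) * zgen (k j)
        + of_int c * (bilinear_ext f (zprod k 1 (j - 1)) (zprod l 1 (i - 1)) * zgen (k j + l i))"
    if i: "0 \<le> i" "i \<le> n" for i
  proof (cases "i = 0")
    case True
    \<comment> \<open>No letter is available for merging, in accordance with \<open>zprod l 1 (- 1) = 0\<close>.\<close>
    have "zprod l 1 (- 1) = 0" by (simp add: zprod_def)
    with True j k n show ?thesis by (simp add: cut_head_def zK zL f L_def del: of_word_Nil)
  next
    case False
    with i have "[1..i] = [1..i - 1] @ [i]" by (simp add: upto_rec2)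
    then have "L [1..i] = L [1..i - 1] @ [z (l i)]" by (simp add: L_def)
    with False i j k l show ?thesis by (simp add: cut_head_def zK zL f)
  qed
  have "K [1..m] = K [1..j - 1] @ z (k j) # K [j + 1..m]"
    using upto_split3[of 1 j m] j by (simp add: K_def)
  then have "bilinear_ext f (zprod k 1 m) (zprod l 1 n)
      = weighted_stuffle c (K [1..j - 1] @ z (k j) # K [j + 1..m]) (L [1..n])"
    using j n by (simp add: zK zL f)
  also have "\<dots> = (\<Sum>i\<le>nat n. cut_head c (K [1..j - 1]) (z (k j)) (take i (L [1..n]))
      * weighted_stuffle c (K [j + 1..m]) (drop i (L [1..n])))"
    by (simp add: weighted_stuffle_cut L_def)
  also have "\<dots> = (\<Sum>i\<in>{0..n}. cut_head c (K [1..j - 1]) (z (k j)) (L [1..i])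
      * weighted_stuffle c (K [j + 1..m]) (L [i + 1..n]))"
    by (rule sum.reindex_bij_witness[of _ nat int])
      (use n in \<open>auto simp: L_def take_map drop_map take_upto drop_upto add.commute\<close>)
  also have "\<dots> = (\<Sum>i\<in>{0..n}. (bilinear_ext f (zprod k 1 (j - 1)) (zprod l 1 i) * zgen (k j)
        + of_int c * (bilinear_ext f (zprod k 1 (j - 1)) (zprod l 1 (i - 1)) * zgen (k j + l i)))
      * bilinear_ext f (zprod k (j + 1) m) (zprod l (i + 1) n))"
    using j by (intro sum.cong) (simp_all add: head zK zL f)
  finally show ?thesis .
qed

theorem theorem1p2:
  fixes m n j :: int and k l :: "int \<Rightarrow> nat"
  assumes "1 \<le> m" and "1 \<le> n"
    and "\<And>i. 1 \<le> i \<Longrightarrow> i \<le> m \<Longrightarrow> 0 < k i"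
    and "\<And>i. 1 \<le> i \<Longrightarrow> i \<le> n \<Longrightarrow> 0 < l i"
    and "1 \<le> j" and "j \<le> m"
  shows "zprod k 1 m \<star> zprod l 1 n =
           (\<Sum>i\<in>{0..n}. ((zprod k 1 (j - 1) \<star> zprod l 1 i) * zgen (k j)
                     + (zprod k 1 (j - 1) \<star> zprod l 1 (i - 1)) * zgen (k j + l i))
                    * (zprod k (j + 1) m \<star> zprod l (i + 1) n))
       \<and> zprod k 1 m \<star>\<^sup>- zprod l 1 n =
           (\<Sum>i\<in>{0..n}. ((zprod k 1 (j - 1) \<star>\<^sup>- zprod l 1 i) * zgen (k j)
                     - (zprod k 1 (j - 1) \<star>\<^sup>- zprod l 1 (i - 1)) * zgen (k j + l i))
                    * (zprod k (j + 1) m \<star>\<^sup>- zprod l (i + 1) n))"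
  using bilinear_ext_zprod_cut[OF stuffle_words_eq_weighted, of m k n l j]
    bilinear_ext_zprod_cut[OF bar_stuffle_words_eq_weighted, of m k n l j] assms
  by (simp add: stuffle_def bar_stuffle_def)

end
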